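(* Let $\lambda_1,\lambda_2,\lambda_1',\lambda_2'\in\mathbb{C}^*$ and let $p,q$ be positive integers with $p\neq q$. Then the following hold: (1) If $\lambda_2/\lambda_1$ is a $p$-th primitive root of unity and $\lambda_2'/\lambda_1'$ is not a root of unity, then the quandle $M_{\lambda_1,\lambda_2}$ is not isomorphic to the quandle $M_{\lambda_1',\lambda_2'}$. (2) If $\lambda_2/\lambda_1$ is a $p$-th primitive root of unity and $\lambda_2'/\lambda_1'$ is a $q$-th primitive root of unity, then $M_{\lambda_1,\lambda_2}$ is not isomorphic to $M_{\lambda_1',\lambda_2'}$.
   Context: A quandle is a non-empty set $Q$ with a binary operation $*$ such that: (Q1) $x*x=x$ for all $x$; (Q2) for all $x,y\in Q$ there is a unique $z\in Q$ with $x=z*y$; (Q3) $(x*y)*z=(x*z)*(y*z)$ for all $x,y,z$. A quandle isomorphism is a bijection $\phi$ with $\phi(x*y)=\phi(x)*\phi(y)$. For $\lambda_1,\lambda_2\in\mathbb{C}^*$, $M_{\lambda_1,\lambda_2}$ is the conjugacy class in $\operatorname{GL}(2,\mathbb{C})$ of $\begin{pmatrix}\lambda_1&0\\0&\lambda_2\end{pmatrix}$, regarded as a quandle with operation $X*Y=Y^{-1}XY$. A complex number $z$ is a root of unity if $z^n=1$ for some positive integer $n$; it is a $p$-th primitive root of unity if $z^p=1$ and $z^k\neq1$ for $1\le k\le p-1$. *)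

theory Defs
  imports "HOL-Analysis.Analysis"
begin

locale quandle =
  fixes Q :: "'a set" and qop :: "'a \<Rightarrow> 'a \<Rightarrow> 'a"  (infixl "\<star>" 70)
  assumes nonempty: "Q \<noteq> {}"
    and closed: "x \<in> Q \<Longrightarrow> y \<in> Q \<Longrightarrow> x \<star> y \<in> Q"
    and idem: "x \<in> Q \<Longrightarrow> x \<star> x = x"
    and unique_div: "x \<in> Q \<Longrightarrow> y \<in> Q \<Longrightarrow> \<exists>!z. z \<in> Q \<and> x = z \<star> y"
    and distrib: "x \<in> Q \<Longrightarrow> y \<in> Q \<Longrightarrow> z \<in> Q \<Longrightarrow> (x \<star> y) \<star> z = (x \<star> z) \<star> (y \<star> z)"

definition quandle_iso ::
    "'a set \<Rightarrow> ('a \<Rightarrow> 'a \<Rightarrow> 'a) \<Rightarrow> 'b set \<Rightarrow> ('b \<Rightarrow> 'b \<Rightarrow> 'b) \<Rightarrow> ('a \<Rightarrow> 'b) \<Rightarrow> bool" where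
  "quandle_iso Q f R g \<phi> \<longleftrightarrow>
     bij_betw \<phi> Q R \<and> (\<forall>x\<in>Q. \<forall>y\<in>Q. \<phi> (f x y) = g (\<phi> x) (\<phi> y))"

definition quandle_isomorphic ::
    "'a set \<Rightarrow> ('a \<Rightarrow> 'a \<Rightarrow> 'a) \<Rightarrow> 'b set \<Rightarrow> ('b \<Rightarrow> 'b \<Rightarrow> 'b) \<Rightarrow> bool" where
  "quandle_isomorphic Q f R g \<longleftrightarrow> (\<exists>\<phi>. quandle_iso Q f R g \<phi>)"

definition GL2 :: "(complex^2^2) set" where
  "GL2 = {A. invertible A}"

definition conj_op :: "complex^2^2 \<Rightarrow> complex^2^2 \<Rightarrow> complex^2^2" where
  "conj_op X Y = matrix_inv Y ** X ** Y"

definition conj_class :: "complex^2^2 \<Rightarrow> (complex^2^2) set" where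
  "conj_class A = {conj_op A P | P. P \<in> GL2}"

definition diag2 :: "complex \<Rightarrow> complex \<Rightarrow> complex^2^2" where
  "diag2 a b = vector [vector [a, 0], vector [0, b]]"

text \<open>The underlying set of the quandle; its operation is \<^const>\<open>conj_op\<close>.\<close>

definition M :: "complex \<Rightarrow> complex \<Rightarrow> (complex^2^2) set" where
  "M l1 l2 = conj_class (diag2 l1 l2)"

definition root_of_unity :: "complex \<Rightarrow> bool" where
  "root_of_unity z \<longleftrightarrow> (\<exists>n::nat. n > 0 \<and> z ^ n = 1)"

definition primitive_root_of_unity :: "nat \<Rightarrow> complex \<Rightarrow> bool" where
  "primitive_root_of_unity p z \<longleftrightarrow> z ^ p = 1 \<and> (\<forall>k. 1 \<le> k \<and> k \<le> p - 1 \<longrightarrow> z ^ k \<noteq> 1)"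

lemma GL2_inv:
  assumes "A \<in> GL2"
  shows "A ** matrix_inv A = mat 1" "matrix_inv A ** A = mat 1" "matrix_inv A \<in> GL2"
proof -
  have "\<exists>A'. A ** A' = mat 1 \<and> A' ** A = mat 1"
    using assms by (auto simp: GL2_def invertible_def)
  then have *: "A ** matrix_inv A = mat 1 \<and> matrix_inv A ** A = mat 1"
    unfolding matrix_inv_def by (rule someI_ex)
  then show "A ** matrix_inv A = mat 1" "matrix_inv A ** A = mat 1" by auto
  from * show "matrix_inv A \<in> GL2" by (auto simp: GL2_def invertible_def)
qed

lemma GL2_inv_unique:
  assumes "A \<in> GL2" "A ** B = mat 1"
  shows "matrix_inv A = B"
  by (metis GL2_inv(2)[OF assms(1)] assms(2) matrix_mul_assoc matrix_mul_lid matrix_mul_rid)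

lemma GL2_mult: "A \<in> GL2 \<Longrightarrow> B \<in> GL2 \<Longrightarrow> A ** B \<in> GL2"
  by (simp add: GL2_def invertible_mult)

lemma GL2_cancel:
  assumes "A \<in> GL2"
  shows "A ** (matrix_inv A ** B) = B" "matrix_inv A ** (A ** B) = B"
  using GL2_inv[OF assms] by (simp_all add: matrix_mul_assoc)

lemma GL2_inv_mult:
  assumes "A \<in> GL2" "B \<in> GL2"
  shows "matrix_inv (A ** B) = matrix_inv B ** matrix_inv A"
  by (rule GL2_inv_unique[OF GL2_mult[OF assms]])
    (simp add: matrix_mul_assoc[symmetric] GL2_cancel assms GL2_inv)

lemma GL2_inv_inv: "A \<in> GL2 \<Longrightarrow> matrix_inv (matrix_inv A) = A"
  by (simp add: GL2_inv GL2_inv_unique)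

lemma diag2_GL2:
  assumes "a \<noteq> 0" "b \<noteq> 0"
  shows "diag2 a b \<in> GL2"
  using assms by (simp add: GL2_def invertible_det_nz det_2 diag2_def)

lemma conj_op_GL2: "A \<in> GL2 \<Longrightarrow> P \<in> GL2 \<Longrightarrow> conj_op A P \<in> GL2"
  by (simp add: conj_op_def GL2_mult GL2_inv)

lemma conj_class_conj:
  assumes "X \<in> conj_class A" "P \<in> GL2"
  shows "conj_op X P \<in> conj_class A"
proof -
  obtain S where S: "S \<in> GL2" "X = conj_op A S"
    using assms(1) by (auto simp: conj_class_def)
  have "conj_op X P = conj_op A (S ** P)"
    by (simp add: S conj_op_def GL2_inv_mult assms matrix_mul_assoc)
  then show ?thesis using S assms GL2_mult by (auto simp: conj_class_def)
qed

lemma quandle_M: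
  assumes "l1 \<noteq> 0" "l2 \<noteq> 0"
  shows "quandle (M l1 l2) conj_op"
proof -
  have GL: "X \<in> GL2" if "X \<in> M l1 l2" for X
    using that diag2_GL2[OF assms] conj_op_GL2 by (auto simp: M_def conj_class_def)
  have cl: "conj_op X P \<in> M l1 l2" if "X \<in> M l1 l2" "P \<in> GL2" for X P
    using that conj_class_conj by (simp add: M_def)
  note s = conj_op_def matrix_mul_assoc[symmetric] GL2_cancel GL2_inv GL2_inv_mult
    GL2_inv_inv GL2_mult
  show ?thesis
  proof
    have "mat 1 \<in> GL2" by (auto simp: GL2_def invertible_def intro!: exI[of _ "mat 1"])
    then show "M l1 l2 \<noteq> {}" by (auto simp: M_def conj_class_def)
  next
    fix X Y assume XY: "X \<in> M l1 l2" "Y \<in> M l1 l2"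
    show "conj_op X Y \<in> M l1 l2" using XY GL cl by blast
    show "\<exists>!Z. Z \<in> M l1 l2 \<and> X = conj_op Z Y"
    proof (rule ex1I[of _ "conj_op X (matrix_inv Y)"])
      show "conj_op X (matrix_inv Y) \<in> M l1 l2 \<and> X = conj_op (conj_op X (matrix_inv Y)) Y"
        using cl[OF XY(1) GL2_inv(3)[OF GL[OF XY(2)]]] GL[OF XY(2)] by (simp add: s)
    next
      fix Z assume "Z \<in> M l1 l2 \<and> X = conj_op Z Y"
      then show "Z = conj_op X (matrix_inv Y)"
        using GL[OF XY(2)] by (simp add: s)
    qed
  next
    fix X assume "X \<in> M l1 l2"
    then show "conj_op X X = X" using GL by (simp add: s)
  next
    fix X Y Z assume "X \<in> M l1 l2" "Y \<in> M l1 l2" "Z \<in> M l1 l2"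
    then show "conj_op (conj_op X Y) Z = conj_op (conj_op X Z) (conj_op Y Z)"
      using GL[of X] GL[of Y] GL[of Z] by (simp add: s)
  qed
qed

end

theory Submission
  imports Defs
begin

text \<open>
  In a quandle every right translation \<open>z \<mapsto> z \<star> y\<close> is a permutation, and an isomorphism
  conjugates the translation by \<open>y\<close> to the translation by its image.  So the set of those
  \<open>n\<close> for which the \<open>n\<close>-th iterate of every right translation is the identity is an isomorphism
  invariant (\<open>translation_exponent_iso\<close>).

  For \<open>M l1 l2\<close> this set is \<open>{n. (l2 / l1) ^ n = 1}\<close> (\<open>translation_exponent_M\<close>).  Indeed,
  conjugation by the diagonal matrix keeps the diagonal entries of a matrix and multiplies the two
  off-diagonal ones by \<open>l2 / l1\<close> and \<open>l1 / l2\<close>; since \<open>M l1 l2\<close> is a single conjugacy class, all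
  its other right translations behave in the same way.  This set contains no positive
  number when the quotient of the eigenvalues is not a root of unity, and its least positive element
  is \<open>p\<close> when that quotient is a \<open>p\<close>-th primitive root of unity, which separates the quandles.
\<close>

definition translation_exponent :: "'a set \<Rightarrow> ('a \<Rightarrow> 'a \<Rightarrow> 'a) \<Rightarrow> nat \<Rightarrow> bool" where
  "translation_exponent Q f n \<longleftrightarrow> (\<forall>x\<in>Q. \<forall>y\<in>Q. ((\<lambda>z. f z y) ^^ n) x = x)"

lemma (in quandle) translation_funpow_closed:
  assumes "x \<in> Q" "y \<in> Q"
  shows "((\<lambda>z. z \<star> y) ^^ n) x \<in> Q"
  by (induction n) (simp_all add: assms closed)

lemma quandle_iso_translation_funpow:
  assumes "quandle Q f" "quandle_iso Q f R g \<phi>" "x \<in> Q" "y \<in> Q"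
  shows "\<phi> (((\<lambda>z. f z y) ^^ n) x) = ((\<lambda>z. g z (\<phi> y)) ^^ n) (\<phi> x)"
  using assms quandle.translation_funpow_closed[OF assms(1,3,4)]
  by (induction n) (simp_all add: quandle_iso_def)

lemma translation_exponent_iso:
  assumes Q: "quandle Q f" and iso: "quandle_iso Q f R g \<phi>"
  shows "translation_exponent Q f n \<longleftrightarrow> translation_exponent R g n"
proof -
  have inj: "inj_on \<phi> Q" and R: "R = \<phi> ` Q"
    using iso by (auto simp: quandle_iso_def bij_betw_def)
  have "((\<lambda>z. g z (\<phi> y)) ^^ n) (\<phi> x) = \<phi> x \<longleftrightarrow> ((\<lambda>z. f z y) ^^ n) x = x"
    if "x \<in> Q" "y \<in> Q" for x y
    using quandle_iso_translation_funpow[OF Q iso that, of n] that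
      inj_on_eq_iff[OF inj quandle.translation_funpow_closed[OF Q that] that(1), of n]
    by simp
  then show ?thesis
    unfolding translation_exponent_def R by blast
qed

lemma matrix_inv_diag2:
  assumes "a \<noteq> 0" "b \<noteq> 0"
  shows "matrix_inv (diag2 a b) = diag2 (1 / a) (1 / b)"
  by (rule GL2_inv_unique[OF diag2_GL2[OF assms]])
    (simp add: assms diag2_def vec_eq_iff forall_2 matrix_matrix_mult_def sum_2 mat_def)

lemma conj_op_diag2:
  assumes "a \<noteq> 0" "b \<noteq> 0"
  shows "conj_op X (diag2 a b) =
    vector [vector [X $ 1 $ 1, X $ 1 $ 2 * (b / a)], vector [X $ 2 $ 1 * (a / b), X $ 2 $ 2]]"
  unfolding conj_op_def matrix_inv_diag2[OF assms]
  using assms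
  by (simp add: diag2_def vec_eq_iff forall_2 matrix_matrix_mult_def sum_2)

lemma funpow_conj_op_diag2:
  assumes "a \<noteq> 0" "b \<noteq> 0"
  shows "((\<lambda>Z. conj_op Z (diag2 a b)) ^^ n) X =
    vector [vector [X $ 1 $ 1, X $ 1 $ 2 * (b / a) ^ n], vector [X $ 2 $ 1 * (a / b) ^ n, X $ 2 $ 2]]"
proof (induction n)
  case 0
  show ?case by (simp add: vec_eq_iff forall_2)
next
  case (Suc n)
  then show ?case
    by (simp add: conj_op_diag2[OF assms] mult_ac)
qed

text \<open>Conjugation by \<open>P\<close> is an automorphism of the conjugation operation on all of the general
  linear group; this carries facts about one element of a conjugacy class to the whole class.\<close>

lemma conj_op_conj_op:
  assumes "Y \<in> GL2" "P \<in> GL2"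
  shows "conj_op (conj_op X P) (conj_op Y P) = conj_op (conj_op X Y) P"
  using assms
  by (simp add: conj_op_def matrix_mul_assoc[symmetric] GL2_cancel GL2_inv GL2_inv_mult
      GL2_inv_inv GL2_mult)

lemma funpow_conj_op_conj_op:
  assumes "Y \<in> GL2" "P \<in> GL2"
  shows "((\<lambda>Z. conj_op Z (conj_op Y P)) ^^ n) (conj_op X P) =
    conj_op (((\<lambda>Z. conj_op Z Y) ^^ n) X) P"
  by (induction n) (simp_all add: conj_op_conj_op assms)

lemma conj_op_matrix_inv_cancel:
  assumes "P \<in> GL2"
  shows "conj_op (conj_op X (matrix_inv P)) P = X"
  using assms by (simp add: conj_op_def matrix_mul_assoc[symmetric] GL2_cancel GL2_inv GL2_inv_inv)

lemma diag2_in_M: "diag2 a b \<in> M a b"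
proof -
  have I: "mat 1 \<in> GL2"
    by (auto simp: GL2_def invertible_def intro!: exI[of _ "mat 1"])
  have "conj_op (diag2 a b) (mat 1) = diag2 a b"
    by (simp add: conj_op_def GL2_inv_unique[OF I, of "mat 1"])
  then show ?thesis
    using I unfolding M_def conj_class_def by force
qed

text \<open>The translation by the diagonal matrix fixes every diagonal matrix, so its order can only be
  read off from a matrix that is not diagonal.  For \<open>a \<noteq> b\<close> this one has a nonzero
  off-diagonal entry.\<close>

lemma upper_triangular_in_M:
  "vector [vector [a, a - b], vector [0, b]] \<in> M a b"
proof -
  define P :: "complex^2^2" where "P = vector [vector [1, 1], vector [0, 1]]"
  have P: "P \<in> GL2"
    by (simp add: GL2_def invertible_det_nz det_2 P_def)
  have "matrix_inv P = vector [vector [1, -1], vector [0, 1]]"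
    by (rule GL2_inv_unique[OF P])
      (simp add: P_def vec_eq_iff forall_2 matrix_matrix_mult_def sum_2 mat_def)
  then have "conj_op (diag2 a b) P = vector [vector [a, a - b], vector [0, b]]"
    by (simp add: conj_op_def diag2_def P_def vec_eq_iff forall_2 matrix_matrix_mult_def sum_2)
  then show ?thesis
    using P unfolding M_def conj_class_def by force
qed

lemma translation_exponent_M:
  assumes "a \<noteq> 0" "b \<noteq> 0"
  shows "translation_exponent (M a b) conj_op n \<longleftrightarrow> (b / a) ^ n = 1"
proof
  assume exponent: "translation_exponent (M a b) conj_op n"
  show "(b / a) ^ n = 1"
  proof (cases "a = b")
    case True
    \<comment> \<open>The class is a single scalar matrix, all translations are trivial and the quotient is 1.\<close>
    then show ?thesis using assms by simp
  next
    case False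
    let ?X = "vector [vector [a, a - b], vector [0, b]] :: complex^2^2"
    have "((\<lambda>Z. conj_op Z (diag2 a b)) ^^ n) ?X = ?X"
      using exponent upper_triangular_in_M diag2_in_M
      unfolding translation_exponent_def by blast
    then have "(((\<lambda>Z. conj_op Z (diag2 a b)) ^^ n) ?X) $ 1 $ 2 = ?X $ 1 $ 2"
      by simp
    then show ?thesis
      unfolding funpow_conj_op_diag2[OF assms] using False by simp
  qed
next
  assume root: "(b / a) ^ n = 1"
  moreover have "(a / b) ^ n = inverse ((b / a) ^ n)"
    by (simp add: power_inverse[symmetric])
  ultimately have diag: "((\<lambda>Z. conj_op Z (diag2 a b)) ^^ n) X = X" for X
    unfolding funpow_conj_op_diag2[OF assms] by (simp add: vec_eq_iff forall_2)
  have "((\<lambda>Z. conj_op Z Y) ^^ n) X = X" if Y_in: "Y \<in> M a b" for X Y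
  proof -
    obtain P where P: "P \<in> GL2" and Y: "Y = conj_op (diag2 a b) P"
      using Y_in by (auto simp: M_def conj_class_def)
    show ?thesis
      using funpow_conj_op_conj_op[OF diag2_GL2[OF assms] P, of n "conj_op X (matrix_inv P)"]
      by (simp add: Y diag conj_op_matrix_inv_cancel[OF P])
  qed
  then show "translation_exponent (M a b) conj_op n"
    by (simp add: translation_exponent_def)
qed

lemma quandle_isomorphic_M_power_eq_1_iff:
  assumes "a \<noteq> 0" "b \<noteq> 0" "c \<noteq> 0" "d \<noteq> 0"
    and "quandle_isomorphic (M a b) conj_op (M c d) conj_op"
  shows "(b / a) ^ n = 1 \<longleftrightarrow> (d / c) ^ n = 1"
proof -
  obtain \<phi> where "quandle_iso (M a b) conj_op (M c d) conj_op \<phi>"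
    using assms(5) by (auto simp: quandle_isomorphic_def)
  from translation_exponent_iso[OF quandle_M[OF assms(1,2)] this] show ?thesis
    by (simp add: translation_exponent_M assms(1-4))
qed

lemma primitive_root_of_unity_unique:
  assumes "primitive_root_of_unity p z" "primitive_root_of_unity q w" "p > 0" "q > 0"
    and same: "\<And>n. z ^ n = 1 \<longleftrightarrow> w ^ n = 1"
  shows "p = q"
proof (rule linorder_cases[of p q])
  assume "p < q"
  then have "w ^ p \<noteq> 1" using assms by (auto simp: primitive_root_of_unity_def)
  then show ?thesis using assms(1) same by (simp add: primitive_root_of_unity_def)
next
  assume "q < p"
  then have "z ^ q \<noteq> 1" using assms by (auto simp: primitive_root_of_unity_def)
  then show ?thesis using assms(2) same by (simp add: primitive_root_of_unity_def)
qed

theorem theorem6p2: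
  fixes l1 l2 l1' l2' :: complex and p q :: nat
  assumes "l1 \<noteq> 0" "l2 \<noteq> 0" "l1' \<noteq> 0" "l2' \<noteq> 0"
    and "p > 0" "q > 0" "p \<noteq> q"
  shows "(primitive_root_of_unity p (l2 / l1) \<and> \<not> root_of_unity (l2' / l1') \<longrightarrow>
            \<not> quandle_isomorphic (M l1 l2) conj_op (M l1' l2') conj_op)
       \<and> (primitive_root_of_unity p (l2 / l1) \<and> primitive_root_of_unity q (l2' / l1') \<longrightarrow>
            \<not> quandle_isomorphic (M l1 l2) conj_op (M l1' l2') conj_op)"
proof (intro conjI impI notI; elim conjE)
  assume iso: "quandle_isomorphic (M l1 l2) conj_op (M l1' l2') conj_op"
  note same = quandle_isomorphic_M_power_eq_1_iff[OF assms(1-4) iso]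
  {
    assume p: "primitive_root_of_unity p (l2 / l1)" and "\<not> root_of_unity (l2' / l1')"
    then have "(l2' / l1') ^ p \<noteq> 1"
      using \<open>p > 0\<close> unfolding root_of_unity_def by blast
    then show False
      using p same unfolding primitive_root_of_unity_def by blast
  next
    assume "primitive_root_of_unity p (l2 / l1)" "primitive_root_of_unity q (l2' / l1')"
    then show False
      using primitive_root_of_unity_unique[OF _ _ \<open>p > 0\<close> \<open>q > 0\<close> same] \<open>p \<noteq> q\<close> by blast
  }
qed

end
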